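(* Let $r \geq 2$, let $a_1 \leq \dots \leq a_r$ be positive integers, and suppose $a_r = b_1 + \dots + b_s$, where $s \geq 1$ and $b_1, \dots, b_s$ are positive integers with $b_i \geq a_{r-1}$ for every $i = 1, \dots, s$. Then $$F(a_1, \dots, a_r; a_r + 1) \leq \sum_{i=1}^{s} F(a_1, \dots, a_{r-1}, b_i; b_i + 1).$$
   Context: All graphs are finite, undirected, without loops or multiple edges. $V(G)$ denotes the vertex set of $G$. A $p$-clique of $G$ is a set of $p$ pairwise adjacent vertices, and $cl(G)$ is the largest $p$ such that $G$ contains a $p$-clique. For positive integers $a_1,\dots,a_r$, an $r$-coloring $V(G) = V_1 \cup \dots \cup V_r$ (with $V_i \cap V_j = \emptyset$ for $i \neq j$) is called $(a_1,\dots,a_r)$-free if, for each $i$, $V_i$ does not contain an $a_i$-clique. The notation $G \rightarrow (a_1,\dots,a_r)$ means that there is no $(a_1,\dots,a_r)$-free $r$-coloring of $V(G)$. For a positive integer $q$, the vertex Folkman number is $$F(a_1,\dots,a_r;q) = \min\{|V(G)| : G \rightarrow (a_1,\dots,a_r) \text{ and } cl(G) < q\}.$$ By a theorem of Folkman, such graphs $G$ exist (so the minimum is well defined) if and only if $q > \max\{a_1,\dots,a_r\}$. *)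

theory Defs
  imports "Graph_Theory.Pair_Digraph"
begin

text \<open>
  As in the Graph-Theory library, finite simple graphs are represented as finite,
  symmetric, loop-free sets of pairs: the locale predicate \<^locale>\<open>pair_graph\<close>.
\<close>

definition clique :: "'a pair_pre_digraph \<Rightarrow> nat \<Rightarrow> 'a set \<Rightarrow> bool" where
  "clique G p K \<longleftrightarrow>
     K \<subseteq> pverts G \<and> finite K \<and> card K = p \<and>
     (\<forall>u\<in>K. \<forall>v\<in>K. u \<noteq> v \<longrightarrow> (u, v) \<in> parcs G)"

definition cl :: "'a pair_pre_digraph \<Rightarrow> nat" where
  "cl G = Max {p. \<exists>K. clique G p K}"

text \<open>
  In an \<open>r\<close>-coloring, color classes may be empty. For a list \<open>as\<close> of length \<open>r\<close>, the classes are
  indexed by \<open>0, \<dots>, r - 1\<close>, in accordance with list indexing.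
\<close>

definition coloring :: "'a pair_pre_digraph \<Rightarrow> nat \<Rightarrow> (nat \<Rightarrow> 'a set) \<Rightarrow> bool" where
  "coloring G r V \<longleftrightarrow>
     pverts G = (\<Union>i<r. V i) \<and> (\<forall>i<r. \<forall>j<r. i \<noteq> j \<longrightarrow> V i \<inter> V j = {})"

definition free_coloring :: "'a pair_pre_digraph \<Rightarrow> nat list \<Rightarrow> (nat \<Rightarrow> 'a set) \<Rightarrow> bool" where
  "free_coloring G as V \<longleftrightarrow>
     coloring G (length as) V \<and> (\<forall>i<length as. \<not> (\<exists>K\<subseteq>V i. clique G (as ! i) K))"

definition vertex_arrows :: "'a pair_pre_digraph \<Rightarrow> nat list \<Rightarrow> bool" where
  "vertex_arrows G as \<longleftrightarrow> \<not> (\<exists>V. free_coloring G as V)"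

text \<open>
  All notions above are invariant under graph isomorphism and every finite graph is isomorphic to
  one whose vertices are natural numbers, so the minimum may be taken over graphs on
  \<^typ>\<open>nat\<close>. By Folkman's theorem it exists if and only if \<open>q\<close> exceeds every entry of \<open>as\<close>
  (for nonempty lists of positive integers); otherwise the value is unspecified.
\<close>

definition folkman :: "nat list \<Rightarrow> nat \<Rightarrow> nat" where
  "folkman as q =
     (LEAST n. \<exists>G :: nat pair_pre_digraph.
        pair_graph G \<and> vertex_arrows G as \<and> cl G < q \<and> card (pverts G) = n)"

end

theory Submission
  imports Defs
begin

text \<open>
  If \<open>G\<^sub>i\<close> is optimal for \<open>F(a\<^sub>1, \<dots>, a\<^sub>r\<^sub>-\<^sub>1, b\<^sub>i; b\<^sub>i + 1)\<close>, then the join of the \<open>G\<^sub>i\<close> has clique number at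
  most \<open>b\<^sub>1 + \<dots> + b\<^sub>s = a\<^sub>r\<close>. In a coloring of it without an \<open>a\<^sub>j\<close>-clique of color \<open>j < r\<close>, every \<open>G\<^sub>i\<close>
  contains a \<open>b\<^sub>i\<close>-clique of color \<open>r\<close>, and these cliques together form an \<open>a\<^sub>r\<close>-clique.

  That optimal \<open>G\<^sub>i\<close> exist is Folkman's theorem, proved by induction on \<open>a\<^sub>1 + \<dots> + a\<^sub>r\<close> with a
  construction in the style of Tutte. Let \<open>H\<^sub>i\<close> be a graph for the parameters with \<open>a\<^sub>i\<close> decreased by
  one. Take a large independent set \<open>X\<close>, and for every \<open>i\<close> and every injection \<open>f\<close> of the
  \<open>(a\<^sub>i - 1)\<close>-cliques of \<open>H\<^sub>i\<close> into \<open>X\<close> a new copy of \<open>H\<^sub>i\<close>, in which each such clique \<open>K\<close> is joined to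
  the vertex \<open>f K\<close>. Some color \<open>i\<close> is so frequent on \<open>X\<close> that some \<open>f\<close> has only values of
  color \<open>i\<close>; then an \<open>(a\<^sub>i - 1)\<close>-clique \<open>K\<close> of color \<open>i\<close> in the corresponding copy of \<open>H\<^sub>i\<close> extends by
  \<open>f K\<close> to an \<open>a\<^sub>i\<close>-clique of color \<open>i\<close>. The new cliques have at most \<open>max a\<^sub>i\<close> vertices as \<open>f\<close> is injective.
\<close>

section \<open>Elementary forms of graphs, clique number and arrowing\<close>

lemma pair_graph_iff:
  "pair_graph G \<longleftrightarrow> finite (pverts G) \<and> parcs G \<subseteq> pverts G \<times> pverts G \<and>
     (\<forall>u v. (u, v) \<in> parcs G \<longrightarrow> u \<noteq> v \<and> (v, u) \<in> parcs G)"
proof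
  assume "pair_graph G"
  then interpret pair_graph G .
  show "finite (pverts G) \<and> parcs G \<subseteq> pverts G \<times> pverts G \<and>
     (\<forall>u v. (u, v) \<in> parcs G \<longrightarrow> u \<noteq> v \<and> (v, u) \<in> parcs G)"
    using arcs_symmetric no_loops' in_arcsD1 in_arcsD2 by fastforce
next
  assume G: "finite (pverts G) \<and> parcs G \<subseteq> pverts G \<times> pverts G \<and>
     (\<forall>u v. (u, v) \<in> parcs G \<longrightarrow> u \<noteq> v \<and> (v, u) \<in> parcs G)"
  then have "finite (parcs G)"
    by (meson finite_SigmaI finite_subset)
  with G show "pair_graph G"
    by unfold_locales (auto simp: symmetric_def intro!: symI)
qed

text \<open>Finiteness of the vertex set bounds the clique sizes, and the empty clique makes the set
  of sizes nonempty, so the \<open>Max\<close> in \<open>cl\<close> is a genuine maximum.\<close>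

lemma cl_less_iff:
  assumes "finite (pverts G)"
  shows "cl G < q \<longleftrightarrow> (\<forall>p K. clique G p K \<longrightarrow> p < q)"
proof -
  let ?S = "{p. \<exists>K. clique G p K}"
  have "?S \<subseteq> {..card (pverts G)}"
    using assms by (auto simp: clique_def intro: card_mono)
  then have "finite ?S"
    by (rule finite_subset) simp
  moreover have "0 \<in> ?S"
    by (auto simp: clique_def)
  ultimately show ?thesis
    unfolding cl_def by (subst Max_less_iff) auto
qed

text \<open>A partition into classes amounts to a color function \<open>c\<close>, which is easier
  to restrict to copies of a graph than a family of sets.\<close>

lemma vertex_arrows_iff:
  "vertex_arrows G as \<longleftrightarrow>
     (\<forall>c. (\<forall>v\<in>pverts G. c v < length as) \<longrightarrow>
        (\<exists>i<length as. \<exists>K. clique G (as ! i) K \<and> (\<forall>v\<in>K. c v = i)))"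
    (is "_ \<longleftrightarrow> ?rhs")
proof
  assume arrows: "vertex_arrows G as"
  show ?rhs
  proof (intro allI impI)
    fix c :: "'a \<Rightarrow> nat" assume c: "\<forall>v\<in>pverts G. c v < length as"
    have "coloring G (length as) (\<lambda>i. {v \<in> pverts G. c v = i})"
      using c by (auto simp: coloring_def)
    with arrows obtain i K where "i < length as" "K \<subseteq> {v \<in> pverts G. c v = i}"
      "clique G (as ! i) K"
      unfolding vertex_arrows_def free_coloring_def by blast
    then show "\<exists>i<length as. \<exists>K. clique G (as ! i) K \<and> (\<forall>v\<in>K. c v = i)"
      by blast
  qed
next
  assume rhs: ?rhs
  show "vertex_arrows G as"
    unfolding vertex_arrows_def
  proof
    assume "\<exists>V. free_coloring G as V"
    then obtain V where V: "free_coloring G as V" ..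
    then have "\<forall>v\<in>pverts G. \<exists>i. i < length as \<and> v \<in> V i"
      by (auto simp: free_coloring_def coloring_def)
    then obtain c where c: "\<forall>v\<in>pverts G. c v < length as \<and> v \<in> V (c v)"
      by metis
    then obtain i K where iK: "i < length as" "clique G (as ! i) K" "\<forall>v\<in>K. c v = i"
      using rhs by blast
    moreover have "K \<subseteq> V i"
      using iK c by (auto simp: clique_def)
    ultimately show False
      using V by (auto simp: free_coloring_def)
  qed
qed

section \<open>Folkman graphs over arbitrary vertex types\<close>

text \<open>The condition minimized in \<open>folkman\<close>, but at any vertex type: the
  constructions below have pairs and sums as vertices.\<close>

definition folkman_graph :: "'a pair_pre_digraph \<Rightarrow> nat list \<Rightarrow> nat \<Rightarrow> bool" where
  "folkman_graph G as q \<longleftrightarrow> pair_graph G \<and> vertex_arrows G as \<and> cl G < q"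

text \<open>An injection of the finite vertex set into the naturals carries \<open>G\<close> to an
  isomorphic copy, so graphs over other types count for \<open>folkman\<close> as well.\<close>

lemma folkman_graph_nat:
  fixes G :: "'a pair_pre_digraph"
  assumes "folkman_graph G as q"
  obtains H :: "nat pair_pre_digraph"
    where "folkman_graph H as q" "card (pverts H) = card (pverts G)"
proof -
  have G: "pair_graph G" "vertex_arrows G as" "cl G < q"
    using assms by (auto simp: folkman_graph_def)
  have fin: "finite (pverts G)" and arcs: "parcs G \<subseteq> pverts G \<times> pverts G"
    using G(1) by (auto simp: pair_graph_iff)
  obtain f :: "'a \<Rightarrow> nat" where f: "inj_on f (pverts G)"
    using finite_imp_inj_to_nat_seg[OF fin] by blast
  define H where "H = \<lparr>pverts = f ` pverts G, parcs = map_prod f f ` parcs G\<rparr>"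
  have [simp]: "pverts H = f ` pverts G" and arcsH: "parcs H = map_prod f f ` parcs G"
    by (simp_all add: H_def)
  have mem: "(f u, f v) \<in> parcs H \<longleftrightarrow> (u, v) \<in> parcs G" if "u \<in> pverts G" "v \<in> pverts G" for u v
  proof
    assume "(f u, f v) \<in> parcs H"
    then obtain u' v' where "(u', v') \<in> parcs G" "f u = f u'" "f v = f v'"
      by (auto simp: arcsH)
    then show "(u, v) \<in> parcs G"
      using that arcs f by (metis inj_onD mem_Sigma_iff subsetD)
  qed (auto simp: arcsH)
  have clique_image: "clique H p (f ` K)" if "clique G p K" for p K
  proof -
    have K: "K \<subseteq> pverts G"
      using that by (simp add: clique_def)
    then have "card (f ` K) = card K"
      by (meson card_image f inj_on_subset)
    with K that show ?thesis
      unfolding clique_def by (auto simp: subset_iff mem)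
  qed
  have clique_bound: "p < q" if "clique H p L" for p L
  proof -
    \<comment> \<open>As \<open>f\<close> is injective on the vertices, this preimage of the clique
      \<open>L\<close> is a clique of \<open>G\<close> of the same size.\<close>
    define K where "K = f -` L \<inter> pverts G"
    have L: "L \<subseteq> f ` pverts G"
      using that by (simp add: clique_def)
    have "f ` K = L"
      using L by (auto simp: K_def)
    moreover have "inj_on f K"
      using f by (rule inj_on_subset) (simp add: K_def)
    ultimately have "card K = p"
      using that by (auto simp: clique_def card_image)
    moreover have "(u, v) \<in> parcs G" if "u \<in> K" "v \<in> K" "u \<noteq> v" for u v
    proof -
      have "f u \<noteq> f v"
        using that \<open>inj_on f K\<close> by (auto dest: inj_onD)
      then show ?thesis
        using that \<open>clique H p L\<close> by (simp add: clique_def K_def flip: mem)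
    qed
    ultimately have "clique G p K"
      using fin by (auto simp: clique_def K_def)
    then show ?thesis
      using G(3) fin by (auto simp: cl_less_iff)
  qed
  have "vertex_arrows H as"
    unfolding vertex_arrows_iff
  proof (intro allI impI)
    fix c assume c: "\<forall>v\<in>pverts H. c v < length as"
    then have "\<forall>v\<in>pverts G. (c \<circ> f) v < length as"
      by simp
    then obtain i K where "i < length as" "clique G (as ! i) K" "\<forall>v\<in>K. (c \<circ> f) v = i"
      using G(2) unfolding vertex_arrows_iff by blast
    then show "\<exists>i<length as. \<exists>K. clique H (as ! i) K \<and> (\<forall>v\<in>K. c v = i)"
      using clique_image by (intro exI[of _ i] conjI exI[of _ "f ` K"]) auto
  qed
  moreover have "pair_graph H"
    unfolding pair_graph_iff
  proof (intro conjI allI impI)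
    show "parcs H \<subseteq> pverts H \<times> pverts H"
      using arcs by (auto simp: arcsH)
  next
    fix u v assume "(u, v) \<in> parcs H"
    then obtain x y where xy: "(x, y) \<in> parcs G" "u = f x" "v = f y"
      by (auto simp: arcsH)
    then have "x \<in> pverts G" "y \<in> pverts G" "x \<noteq> y" "(y, x) \<in> parcs G"
      using G(1) unfolding pair_graph_iff by blast+
    then show "u \<noteq> v" "(v, u) \<in> parcs H"
      using xy mem f by (auto dest: inj_onD)
  qed (simp add: fin)
  moreover have "cl H < q"
    using clique_bound fin by (simp add: cl_less_iff)
  ultimately have "folkman_graph H as q"
    by (simp add: folkman_graph_def)
  moreover have "card (pverts H) = card (pverts G)"
    using f by (simp add: card_image)
  ultimately show thesis
    by (rule that)
qed

lemma folkman_le: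
  fixes G :: "'a pair_pre_digraph"
  assumes "folkman_graph G as q"
  shows "folkman as q \<le> card (pverts G)"
proof -
  obtain H :: "nat pair_pre_digraph"
    where "folkman_graph H as q" "card (pverts H) = card (pverts G)"
    using folkman_graph_nat[OF assms] .
  then show ?thesis
    unfolding folkman_def folkman_graph_def by (intro Least_le) blast
qed

text \<open>The \<open>LEAST\<close> in \<open>folkman\<close> is attained only if some witness
  exists; \<open>G\<close> provides one.\<close>

lemma folkman_attained:
  fixes G :: "'a pair_pre_digraph"
  assumes "folkman_graph G as q"
  obtains H :: "nat pair_pre_digraph"
    where "folkman_graph H as q" "card (pverts H) = folkman as q"
proof -
  let ?P = "\<lambda>n. \<exists>H :: nat pair_pre_digraph.
    pair_graph H \<and> vertex_arrows H as \<and> cl H < q \<and> card (pverts H) = n"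
  obtain H :: "nat pair_pre_digraph"
    where "folkman_graph H as q" "card (pverts H) = card (pverts G)"
    using folkman_graph_nat[OF assms] .
  then have "?P (card (pverts G))"
    unfolding folkman_graph_def by blast
  then have "?P (folkman as q)"
    unfolding folkman_def by (rule LeastI)
  then show thesis
    using that unfolding folkman_graph_def by blast
qed

section \<open>Joins of graphs\<close>

text \<open>Index tags make the copies disjoint. For \<open>i \<noteq> j\<close> the implication is
  vacuous, so distinct copies are completely joined.\<close>

definition join :: "'i set \<Rightarrow> ('i \<Rightarrow> 'a pair_pre_digraph) \<Rightarrow> ('i \<times> 'a) pair_pre_digraph" where
  "join I g =
     (let V = Sigma I (\<lambda>i. pverts (g i)) in
      \<lparr>pverts = V,
       parcs = {((i, u), (j, v)). (i, u) \<in> V \<and> (j, v) \<in> V \<and> (i = j \<longrightarrow> (u, v) \<in> parcs (g i))}\<rparr>)"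

text \<open>The cliques of a join are the disjoint unions of cliques of the copies. Hence clique
  bounds add up over \<open>I\<close>, and so do the sizes of cliques in the last color.\<close>

lemma folkman_graph_join:
  assumes "finite I"
    and g: "\<And>i. i \<in> I \<Longrightarrow> folkman_graph (g i) (as @ [b i]) (b i + 1)"
  shows "folkman_graph (join I g) (as @ [sum b I]) (sum b I + 1)"
proof -
  have gr: "pair_graph (g i)" and arr: "vertex_arrows (g i) (as @ [b i])"
    and cl: "cl (g i) < b i + 1" and fin: "finite (pverts (g i))" if "i \<in> I" for i
    using g[OF that] by (auto simp: folkman_graph_def pair_graph_iff)
  have vs: "pverts (join I g) = Sigma I (\<lambda>i. pverts (g i))"
    by (simp add: join_def)
  have mem: "((i, u), (j, v)) \<in> parcs (join I g) \<longleftrightarrow>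
      i \<in> I \<and> j \<in> I \<and> u \<in> pverts (g i) \<and> v \<in> pverts (g j) \<and> (i = j \<longrightarrow> (u, v) \<in> parcs (g i))"
    for i j u v
    by (auto simp: join_def)
  have finV: "finite (pverts (join I g))"
    using \<open>finite I\<close> fin by (auto simp: vs)
  have "pair_graph (join I g)"
    unfolding pair_graph_iff
  proof (intro conjI allI impI)
    show "parcs (join I g) \<subseteq> pverts (join I g) \<times> pverts (join I g)"
      by (auto simp: mem vs)
  next
    fix u v assume "(u, v) \<in> parcs (join I g)"
    then obtain i x j y where uv: "u = (i, x)" "v = (j, y)" "((i, x), (j, y)) \<in> parcs (join I g)"
      by (metis surj_pair)
    moreover have "x \<noteq> y \<and> (y, x) \<in> parcs (g i)" if "i = j"
      using gr[of i] uv that unfolding mem pair_graph_iff by blast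
    ultimately show "u \<noteq> v" "(v, u) \<in> parcs (join I g)"
      by (auto simp: mem)
  qed (rule finV)
  moreover have "cl (join I g) < sum b I + 1"
    unfolding cl_less_iff[OF finV]
  proof (intro allI impI)
    fix p K assume K: "clique (join I g) p K"
    \<comment> \<open>The slices of \<open>K\<close> are cliques of the single \<open>g i\<close>,
      and their sizes add up to \<open>p\<close>.\<close>
    define L where "L i = {v. (i, v) \<in> K}" for i
    have KV: "K \<subseteq> Sigma I (\<lambda>i. pverts (g i))"
      using K by (simp add: clique_def vs)
    then have KL: "K = Sigma I L"
      by (auto simp: L_def)
    have finL: "finite (L i)" if "i \<in> I" for i
    proof (rule finite_subset)
      show "L i \<subseteq> pverts (g i)"
        using KV by (auto simp: L_def)
    qed (rule fin[OF that])
    have "card (L i) \<le> b i" if "i \<in> I" for i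
    proof -
      have "clique (g i) (card (L i)) (L i)"
        using K KV finL[OF that] unfolding clique_def by (fastforce simp: L_def mem)
      then show ?thesis
        using cl[OF that] fin[OF that] by (auto simp: cl_less_iff)
    qed
    moreover have "p = (\<Sum>i\<in>I. card (L i))"
      using K \<open>finite I\<close> finL unfolding KL by (auto simp: clique_def)
    ultimately show "p < sum b I + 1"
      by (simp add: sum_mono less_Suc_eq_le)
  qed
  moreover have "vertex_arrows (join I g) (as @ [sum b I])"
    unfolding vertex_arrows_iff
  proof (intro allI impI)
    fix c assume c: "\<forall>v\<in>pverts (join I g). c v < length (as @ [sum b I])"
    have ex: "\<exists>j K. j \<le> length as \<and> clique (g i) ((as @ [b i]) ! j) K \<and> (\<forall>v\<in>K. c (i, v) = j)"
      if "i \<in> I" for i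
    proof -
      have "\<forall>v\<in>pverts (g i). c (i, v) < length (as @ [b i])"
        using c that by (auto simp: vs)
      then have "\<exists>j<length (as @ [b i]). \<exists>K. clique (g i) ((as @ [b i]) ! j) K \<and> (\<forall>v\<in>K. c (i, v) = j)"
        by (rule arr[OF that, unfolded vertex_arrows_iff, THEN spec, of "\<lambda>v. c (i, v)", THEN mp])
      then show ?thesis
        by (auto simp: less_Suc_eq_le)
    qed
    show "\<exists>j<length (as @ [sum b I]). \<exists>K.
      clique (join I g) ((as @ [sum b I]) ! j) K \<and> (\<forall>v\<in>K. c v = j)"
    proof (cases "\<exists>i\<in>I. \<exists>j K. j < length as \<and> clique (g i) (as ! j) K \<and> (\<forall>v\<in>K. c (i, v) = j)")
      case True
      then obtain i j K where K: "i \<in> I" "j < length as" "clique (g i) (as ! j) K"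
        "\<forall>v\<in>K. c (i, v) = j"
        by blast
      have "card (Pair i ` K) = card K"
        by (intro card_image) (simp add: inj_on_def)
      then have "clique (join I g) (as ! j) (Pair i ` K)"
        using K by (auto simp: clique_def mem vs)
      then show ?thesis
        using K by (intro exI[of _ j] conjI exI[of _ "Pair i ` K"]) (auto simp: nth_append)
    next
      \<comment> \<open>Without a clique in an earlier color, each copy has a
        \<open>b i\<close>-clique of color \<open>length as\<close>, the last color when counting
        from 0.\<close>
      case False
      then have "\<forall>i\<in>I. \<exists>K. clique (g i) (b i) K \<and> (\<forall>v\<in>K. c (i, v) = length as)"
        using ex by (metis le_neq_implies_less nth_append nth_append_length)
      then obtain L where L: "\<And>i. i \<in> I \<Longrightarrow> clique (g i) (b i) (L i)"
        "\<And>i v. i \<in> I \<Longrightarrow> v \<in> L i \<Longrightarrow> c (i, v) = length as"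
        by metis
      have "finite (Sigma I L)" "card (Sigma I L) = sum b I"
        using \<open>finite I\<close> L(1) by (auto simp: clique_def)
      then have "clique (join I g) (sum b I) (Sigma I L)"
        using L(1) unfolding clique_def by (fastforce simp: mem vs)
      then show ?thesis
        using L(2) by (intro exI[of _ "length as"] conjI exI[of _ "Sigma I L"]) auto
    qed
  qed
  ultimately show ?thesis
    by (simp add: folkman_graph_def)
qed

section \<open>The Tutte-style attachment\<close>

text \<open>\<open>Inl x\<close> is a point of the independent set; \<open>Inr (i, f, v)\<close> is
  the vertex \<open>v\<close> in the copy of \<open>H i\<close> that belongs to the injection
  \<open>f\<close>.\<close>

fun attach_adj :: "('i \<Rightarrow> 'a pair_pre_digraph) \<Rightarrow> ('i \<Rightarrow> 'a set set) \<Rightarrow>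
    'x + 'i \<times> ('a set \<Rightarrow> 'x) \<times> 'a \<Rightarrow> 'x + 'i \<times> ('a set \<Rightarrow> 'x) \<times> 'a \<Rightarrow> bool" where
  "attach_adj H C (Inl x) (Inl y) \<longleftrightarrow> False"
| "attach_adj H C (Inl x) (Inr (i, f, v)) \<longleftrightarrow> (\<exists>K\<in>C i. f K = x \<and> v \<in> K)"
| "attach_adj H C (Inr (i, f, v)) (Inl x) \<longleftrightarrow> (\<exists>K\<in>C i. f K = x \<and> v \<in> K)"
| "attach_adj H C (Inr (i, f, u)) (Inr (j, g, v)) \<longleftrightarrow> i = j \<and> f = g \<and> (u, v) \<in> parcs (H i)"

text \<open>Taking extensional functions identifies injections that agree on \<open>C i\<close>, so
  finite \<open>C i\<close> and \<open>X\<close> yield finitely many copies.\<close>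

definition attach_verts :: "'i set \<Rightarrow> 'x set \<Rightarrow> ('i \<Rightarrow> 'a pair_pre_digraph) \<Rightarrow> ('i \<Rightarrow> 'a set set) \<Rightarrow>
    ('x + 'i \<times> ('a set \<Rightarrow> 'x) \<times> 'a) set" where
  "attach_verts I X H C =
     X <+> (SIGMA i:I. {f \<in> C i \<rightarrow>\<^sub>E X. inj_on f (C i)} \<times> pverts (H i))"

definition attach :: "'i set \<Rightarrow> 'x set \<Rightarrow> ('i \<Rightarrow> 'a pair_pre_digraph) \<Rightarrow> ('i \<Rightarrow> 'a set set) \<Rightarrow>
    ('x + 'i \<times> ('a set \<Rightarrow> 'x) \<times> 'a) pair_pre_digraph" where
  "attach I X H C =
     \<lparr>pverts = attach_verts I X H C,
      parcs = {(u, v). u \<in> attach_verts I X H C \<and> v \<in> attach_verts I X H C \<and> attach_adj H C u v}\<rparr>"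

lemma attach_simps [simp]:
  "pverts (attach I X H C) = attach_verts I X H C"
  "(u, v) \<in> parcs (attach I X H C) \<longleftrightarrow>
     u \<in> attach_verts I X H C \<and> v \<in> attach_verts I X H C \<and> attach_adj H C u v"
  "Inl x \<in> attach_verts I X H C \<longleftrightarrow> x \<in> X"
  "Inr (i, f, w) \<in> attach_verts I X H C \<longleftrightarrow>
     i \<in> I \<and> f \<in> C i \<rightarrow>\<^sub>E X \<and> inj_on f (C i) \<and> w \<in> pverts (H i)"
  by (auto simp: attach_def attach_verts_def)

lemma attach_pair_graph:
  assumes "finite I" "finite X" "\<And>i. i \<in> I \<Longrightarrow> pair_graph (H i)" "\<And>i. i \<in> I \<Longrightarrow> finite (C i)"
  shows "pair_graph (attach I X H C)"
proof -
  have "finite (attach_verts I X H C)"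
    unfolding attach_verts_def using assms
    by (intro finite_Plus finite_SigmaI finite_cartesian_product)
       (auto simp: pair_graph_iff intro: finite_subset[OF _ finite_PiE[of "C i" "\<lambda>_. X" for i]])
  moreover have "u \<noteq> v \<and> attach_adj H C v u"
    if "attach_adj H C u v" "u \<in> attach_verts I X H C" "v \<in> attach_verts I X H C" for u v
    using that assms(3)
    by (cases "(H, C, u, v)" rule: attach_adj.cases) (auto simp: pair_graph_iff)
  ultimately show ?thesis
    unfolding pair_graph_iff by auto
qed

text \<open>A clique has at most one vertex \<open>Inl x\<close>, and its other vertices share one
  copy. If \<open>x\<close> is present, injectivity of \<open>f\<close> puts them into a single
  member of \<open>C i\<close>, of size below \<open>p\<close>; otherwise the clique comes from
  \<open>H i\<close> or is a single point.\<close>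

lemma attach_clique_le:
  assumes L: "clique (attach I X H C) m L"
    and H: "\<And>i n K. i \<in> I \<Longrightarrow> clique (H i) n K \<Longrightarrow> n \<le> p"
    and C: "\<And>i K. i \<in> I \<Longrightarrow> K \<in> C i \<Longrightarrow> finite K \<and> card K < p"
    and "0 < p"
  shows "m \<le> p"
proof -
  have LV: "L \<subseteq> attach_verts I X H C" and finL: "finite L" and m: "m = card L"
    and adj: "\<And>u v. u \<in> L \<Longrightarrow> v \<in> L \<Longrightarrow> u \<noteq> v \<Longrightarrow> attach_adj H C u v"
    using L by (auto simp: clique_def)
  show ?thesis
  proof (cases "\<exists>w. Inr w \<in> L")
    case False
    have "u = v" if "u \<in> L" "v \<in> L" for u v
      using False adj[OF that] that by (cases u; cases v) auto
    then have "card L \<le> 1"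
      by (auto simp: card_le_Suc0_iff_eq[OF finL])
    then show ?thesis
      using \<open>0 < p\<close> m by simp
  next
    case True
    then obtain i f v where v: "Inr (i, f, v) \<in> L"
      by auto
    then have i: "i \<in> I" "inj_on f (C i)"
      using LV by auto
    have copy: "j = i \<and> g = f" if "Inr (j, g, u) \<in> L" for j g u
      using adj[OF that v] by auto
    show ?thesis
    proof (cases "\<exists>x. Inl x \<in> L")
      case True
      then obtain x where x: "Inl x \<in> L" ..
      obtain K where K: "K \<in> C i" "f K = x"
        using adj[OF x v] by auto
      have "L \<subseteq> insert (Inl x) ((\<lambda>u. Inr (i, f, u)) ` K)"
      proof
        fix w assume w: "w \<in> L"
        show "w \<in> insert (Inl x) ((\<lambda>u. Inr (i, f, u)) ` K)"
        proof (cases w)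
          case (Inl y)
          then show ?thesis
            using adj[OF w x] by auto
        next
          case (Inr z)
          then obtain u where u: "w = Inr (i, f, u)"
            using copy w by (metis prod_cases3)
          then obtain K' where "K' \<in> C i" "f K' = x" "u \<in> K'"
            using adj[OF x w] by auto
          \<comment> \<open>Both \<open>K\<close> and \<open>K'\<close> are sent to
            \<open>x\<close>, so they coincide.\<close>
          then have "u \<in> K"
            using K i(2) by (metis inj_onD)
          then show ?thesis
            using u by simp
        qed
      qed
      moreover have "finite K" "card K < p"
        using C K i by auto
      ultimately have "card L \<le> card (insert (Inl x) ((\<lambda>u. Inr (i, f, u)) ` K))"
        by (intro card_mono) auto
      also have "\<dots> \<le> Suc (card K)"
        using \<open>finite K\<close> card_image_le[of K "\<lambda>u. Inr (i, f, u)"] by (auto simp: card_insert_if)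
      finally show ?thesis
        using \<open>card K < p\<close> m by simp
    next
      case False
      define M where "M = {u. Inr (i, f, u) \<in> L}"
      have LM: "L = (\<lambda>u. Inr (i, f, u)) ` M"
      proof (intro equalityI subsetI)
        fix w assume w: "w \<in> L"
        then obtain j g u where "w = Inr (j, g, u)"
          using False by (metis old.sum.exhaust prod_cases3)
        then show "w \<in> (\<lambda>u. Inr (i, f, u)) ` M"
          using w copy[of j g u] by (simp add: M_def)
      qed (auto simp: M_def)
      have "card L = card M"
        unfolding LM by (intro card_image) (simp add: inj_on_def)
      moreover have "finite M"
        using finL unfolding LM by (rule finite_imageD) (simp add: inj_on_def)
      moreover have "(u, w) \<in> parcs (H i)" if "u \<in> M" "w \<in> M" "u \<noteq> w" for u w
        using adj[of "Inr (i, f, u)" "Inr (i, f, w)"] that by (simp add: M_def)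
      moreover have "M \<subseteq> pverts (H i)"
        using LV by (auto simp: M_def)
      ultimately have "clique (H i) m M"
        by (simp add: clique_def m)
      then show ?thesis
        using H i by blast
    qed
  qed
qed

text \<open>If every color occurred fewer than \<open>n\<close> times, fewer than
  \<open>r * n\<close> points would be colored.\<close>

lemma pigeonhole_color:
  fixes c :: "nat \<Rightarrow> nat"
  assumes "0 < r" "\<And>x. x < r * n \<Longrightarrow> c x < r"
  obtains i where "i < r" "n \<le> card {x. x < r * n \<and> c x = i}"
proof -
  have "\<exists>i<r. n \<le> card {x. x < r * n \<and> c x = i}"
  proof (rule ccontr)
    assume "\<not> (\<exists>i<r. n \<le> card {x. x < r * n \<and> c x = i})"
    then have "(\<Sum>i<r. card {x. x < r * n \<and> c x = i}) < (\<Sum>i<r. n)"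
      using \<open>0 < r\<close> by (intro sum_strict_mono) (auto simp: not_le)
    moreover have "card (\<Union>i<r. {x. x < r * n \<and> c x = i}) = (\<Sum>i<r. card {x. x < r * n \<and> c x = i})"
      by (intro card_UN_disjoint) auto
    moreover have "(\<Union>i<r. {x. x < r * n \<and> c x = i}) = {..<r * n}"
      using assms(2) by auto
    ultimately show False
      by simp
  qed
  then show thesis
    using that by blast
qed

text \<open>Among \<open>length as * n\<close> points some color \<open>i\<close> occurs often
  enough to receive an injection of \<open>C i\<close>. In the copy of \<open>H i\<close> for that
  injection, a clique of another color already has full size, and one of color \<open>i\<close>
  gains the point attached to it.\<close>

lemma attach_arrows:
  fixes H :: "nat \<Rightarrow> 'a pair_pre_digraph"
  assumes "as \<noteq> []"
    and pos: "\<And>i. i < length as \<Longrightarrow> 0 < as ! i"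
    and H: "\<And>i. i < length as \<Longrightarrow> vertex_arrows (H i) (as[i := as ! i - 1])"
    and C: "\<And>i. C i = {K. clique (H i) (as ! i - 1) K}"
    and fin: "\<And>i. i < length as \<Longrightarrow> finite (C i)"
    and n: "\<And>i. i < length as \<Longrightarrow> card (C i) \<le> n"
  shows "vertex_arrows (attach {..<length as} {..<length as * n} H C) as"
    (is "vertex_arrows ?G as")
  unfolding vertex_arrows_iff
proof (intro allI impI)
  fix c assume c: "\<forall>v\<in>pverts ?G. c v < length as"
  let ?X = "{..<length as * n}"
  obtain i where i: "i < length as"
    and large: "n \<le> card {x. x < length as * n \<and> c (Inl x) = i}" (is "_ \<le> card ?Y")
    using pigeonhole_color[of "length as" n "\<lambda>x. c (Inl x)"] c \<open>as \<noteq> []\<close> by auto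
  have "card (C i) \<le> card ?Y"
    using n[OF i] large by simp
  then obtain f0 where f0: "f0 ` C i \<subseteq> ?Y" "inj_on f0 (C i)"
    using card_le_inj[OF fin[OF i], of ?Y] by auto
  \<comment> \<open>Restriction makes \<open>f0\<close> extensional, so that \<open>f\<close>
    indexes a copy in the attachment.\<close>
  define f where "f = restrict f0 (C i)"
  have f: "f \<in> C i \<rightarrow>\<^sub>E ?X" "inj_on f (C i)" "\<And>K. K \<in> C i \<Longrightarrow> c (Inl (f K)) = i"
    using f0 by (auto simp: f_def inj_on_def)
  define h where "h v = (Inr (i, f, v) :: nat + nat \<times> ('a set \<Rightarrow> nat) \<times> 'a)" for v
  have h_vert: "h v \<in> pverts ?G \<longleftrightarrow> v \<in> pverts (H i)" for v
    using i f by (simp add: h_def)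
  have copy: "clique ?G m (h ` K)" if "clique (H i) m K" for m K
  proof -
    have "card (h ` K) = card K"
      by (intro card_image) (simp add: inj_on_def h_def)
    then show ?thesis
      using that i f unfolding clique_def by (auto simp: h_def)
  qed
  have "\<forall>v\<in>pverts (H i). (c \<circ> h) v < length (as[i := as ! i - 1])"
    using c h_vert by simp
  then obtain j K where j: "j < length as" and K: "clique (H i) (as[i := as ! i - 1] ! j) K"
    and mono: "\<And>v. v \<in> K \<Longrightarrow> c (h v) = j"
    using H[OF i] unfolding vertex_arrows_iff by (metis comp_apply length_list_update)
  show "\<exists>i<length as. \<exists>K. clique ?G (as ! i) K \<and> (\<forall>v\<in>K. c v = i)"
  proof (cases "j = i")
    \<comment> \<open>The list update changes only position \<open>i\<close>, so \<open>K\<close>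
      already has the size required for color \<open>j\<close>.\<close>
    case False
    then have "clique ?G (as ! j) (h ` K)"
      using K by (auto intro: copy)
    then show ?thesis
      using j mono by (intro exI[of _ j] conjI exI[of _ "h ` K"]) auto
  next
    case True
    then have "K \<in> C i"
      using K i by (simp add: C)
    then have "clique ?G (as ! i - 1) (h ` K)"
      by (auto simp: C intro: copy)
    moreover have "Inl (f K) \<notin> h ` K"
      by (auto simp: h_def)
    moreover have "f K \<in> ?X"
      using f(1) \<open>K \<in> C i\<close> by (rule PiE_mem)
    moreover have "attach_adj H C (Inl (f K)) (h v)" "attach_adj H C (h v) (Inl (f K))" if "v \<in> K" for v
      using that \<open>K \<in> C i\<close> by (auto simp: h_def)
    ultimately have "clique ?G (as ! i) (insert (Inl (f K)) (h ` K))"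
      using pos[OF i] unfolding clique_def by auto
    then show ?thesis
      using i mono f(3)[OF \<open>K \<in> C i\<close>] True
      by (intro exI[of _ i] conjI exI[of _ "insert (Inl (f K)) (h ` K)"]) auto
  qed
qed

section \<open>Folkman's existence theorem\<close>

theorem folkman_graph_exists:
  assumes "as \<noteq> []" "\<And>x. x \<in> set as \<Longrightarrow> x \<le> p"
  shows "\<exists>G :: nat pair_pre_digraph. folkman_graph G as (p + 1)"
  using assms
proof (induction "sum_list as" arbitrary: as rule: less_induct)
  case less
  show ?case
  proof (cases "0 \<in> set as")
    \<comment> \<open>The empty set is a \<open>0\<close>-clique of color \<open>i\<close>, so even
      the empty graph arrows.\<close>
    case True
    then obtain i where "i < length as" "as ! i = 0"
      by (metis in_set_conv_nth)
    moreover have "clique \<lparr>pverts = {}, parcs = {}\<rparr> 0 {}"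
      by (simp add: clique_def)
    ultimately have "vertex_arrows \<lparr>pverts = {} :: nat set, parcs = {}\<rparr> as"
      unfolding vertex_arrows_iff by (metis empty_iff)
    moreover have "cl \<lparr>pverts = {} :: nat set, parcs = {}\<rparr> < p + 1"
      by (subst cl_less_iff) (auto simp: clique_def)
    moreover have "pair_graph \<lparr>pverts = {} :: nat set, parcs = {}\<rparr>"
      by (simp add: pair_graph_iff)
    ultimately show ?thesis
      unfolding folkman_graph_def by blast
  next
    case False
    then have pos: "0 < as ! i" if "i < length as" for i
      using that by (metis bot_nat_0.not_eq_extremum nth_mem)
    have "\<exists>H :: nat pair_pre_digraph. folkman_graph H (as[i := as ! i - 1]) (p + 1)"
      if i: "i < length as" for i
    proof (rule less.hyps)
      show "sum_list (as[i := as ! i - 1]) < sum_list as"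
        using pos[OF i] i elem_le_sum_list[OF i] by (simp add: sum_list_update)
      show "as[i := as ! i - 1] \<noteq> []"
        using less.prems by simp
      show "x \<le> p" if "x \<in> set (as[i := as ! i - 1])" for x
        using that less.prems(2) i
        by (metis diff_le_self insertE le_trans nth_mem set_update_subset_insert subsetD)
    qed
    then obtain H :: "nat \<Rightarrow> nat pair_pre_digraph"
      where H: "\<And>i. i < length as \<Longrightarrow> folkman_graph (H i) (as[i := as ! i - 1]) (p + 1)"
      by metis
    define C where "C i = {K. clique (H i) (as ! i - 1) K}" for i
    \<comment> \<open>The sum serves as a common upper bound for all
      \<open>card (C i)\<close>.\<close>
    define n where "n = (\<Sum>i<length as. card (C i))"
    let ?G = "attach {..<length as} {..<length as * n} H C"
    have graph: "pair_graph (H i)" and finH: "finite (pverts (H i))" if "i < length as" for i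
      using H[OF that] by (auto simp: folkman_graph_def pair_graph_iff)
    have finC: "finite (C i)" if "i < length as" for i
    proof (rule finite_subset)
      show "C i \<subseteq> Pow (pverts (H i))"
        by (auto simp: C_def clique_def)
    qed (simp add: finH that)
    have card_C: "card (C i) \<le> n" if "i < length as" for i
      unfolding n_def using that by (intro member_le_sum) auto
    have G: "pair_graph ?G"
      using graph finC by (intro attach_pair_graph) auto
    moreover have "vertex_arrows ?G as"
      using less.prems(1) pos H finC card_C
      by (intro attach_arrows) (auto simp: folkman_graph_def C_def)
    moreover have "cl ?G < p + 1"
    proof -
      have as_p: "as ! i \<le> p" if "i < length as" for i
        using less.prems(2) that by simp
      have "m \<le> p" if "clique ?G m L" for m L
        using that
      proof (rule attach_clique_le)
        show "k \<le> p" if "i \<in> {..<length as}" "clique (H i) k K" for i k K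
          using H that finH by (fastforce simp: folkman_graph_def cl_less_iff)
        \<comment> \<open>Here \<open>card K = as ! i - 1 < as ! i \<le> p\<close>, the strict step
          because the entry is positive.\<close>
        show "finite K \<and> card K < p" if "i \<in> {..<length as}" "K \<in> C i" for i K
          using that pos[of i] as_p[of i] by (auto simp: C_def clique_def)
        show "0 < p"
          using pos[of 0] as_p[of 0] less.prems(1) by simp
      qed
      moreover have "finite (pverts ?G)"
        using G by (simp only: pair_graph_iff)
      ultimately show ?thesis
        by (simp only: cl_less_iff) (simp add: less_Suc_eq_le)
    qed
    ultimately have "folkman_graph ?G as (p + 1)"
      by (simp add: folkman_graph_def)
    then show ?thesis
      by (rule folkman_graph_nat) blast
  qed
qed

section \<open>The upper bound for the Folkman number\<close>

theorem mainTheorem1: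
  fixes r s :: nat and a b :: "nat \<Rightarrow> nat"
  assumes "r \<ge> 2"
    and "\<And>i. i \<in> {1..r} \<Longrightarrow> a i > 0"
    and "mono_on {1..r} a"
    and "s \<ge> 1"
    and "\<And>i. i \<in> {1..s} \<Longrightarrow> b i > 0"
    and "a r = (\<Sum>i=1..s. b i)"
    and "\<And>i. i \<in> {1..s} \<Longrightarrow> b i \<ge> a (r - 1)"
  shows "folkman (map a [1..<r + 1]) (a r + 1)
           \<le> (\<Sum>i=1..s. folkman (map a [1..<r] @ [b i]) (b i + 1))"
proof -
  let ?as = "map a [1..<r]"
  have "\<exists>G :: nat pair_pre_digraph. folkman_graph G (?as @ [b i]) (b i + 1) \<and>
      card (pverts G) = folkman (?as @ [b i]) (b i + 1)" if i: "i \<in> {1..s}" for i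
  proof -
    \<comment> \<open>Monotonicity and \<open>a (r - 1) \<le> b i\<close> make \<open>b i\<close>
      the largest entry, as the existence theorem requires for clique number below
      \<open>b i + 1\<close>.\<close>
    have "x \<le> b i" if "x \<in> set (?as @ [b i])" for x
    proof (cases "x = b i")
      case False
      then obtain j where "j \<in> {1..<r}" "x = a j"
        using \<open>x \<in> set (?as @ [b i])\<close> by auto
      then have "x \<le> a (r - 1)"
        using monotone_onD[OF assms(3), of j "r - 1"] assms(1) by auto
      then show ?thesis
        using assms(7)[OF i] by simp
    qed simp
    then obtain G :: "nat pair_pre_digraph" where "folkman_graph G (?as @ [b i]) (b i + 1)"
      using folkman_graph_exists[of "?as @ [b i]" "b i"] by blast
    then show ?thesis
      by (rule folkman_attained) blast
  qed
  then obtain g :: "nat \<Rightarrow> nat pair_pre_digraph"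
    where g: "\<And>i. i \<in> {1..s} \<Longrightarrow> folkman_graph (g i) (?as @ [b i]) (b i + 1)"
      and card: "\<And>i. i \<in> {1..s} \<Longrightarrow> card (pverts (g i)) = folkman (?as @ [b i]) (b i + 1)"
    by metis
  have "map a [1..<r + 1] = ?as @ [a r]"
    using assms(1) by simp
  then have "folkman_graph (join {1..s} g) (map a [1..<r + 1]) (a r + 1)"
    using folkman_graph_join[of "{1..s}" g ?as b] g assms(6) by simp
  then have "folkman (map a [1..<r + 1]) (a r + 1) \<le> card (pverts (join {1..s} g))"
    by (rule folkman_le)
  also have "\<dots> = (\<Sum>i=1..s. card (pverts (g i)))"
    using g by (simp add: join_def folkman_graph_def pair_graph_iff)
  also have "\<dots> = (\<Sum>i=1..s. folkman (?as @ [b i]) (b i + 1))"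
    by (simp add: card)
  finally show ?thesis .
qed

end
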